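(* Let $n\ge 0$ be an integer. For every integer $k$ with $0\le k\le n$: (a) the number of abelian words $ww'$ of length $2n$ over the alphabet $\{1,2,3\}$ such that $w$ contains exactly $n-k$ letters equal to $1$ is $\binom{n}{k}^{2}\binom{2k}{k}$; (b) the number of abelian words $ww'$ of length $2n$ over the alphabet $\{1,2,3\}$ such that there are exactly $n-k$ positions $p\in\{1,\dots,n\}$ in which both $w$ and $w'$ have the letter $1$ is $\binom{n}{k}\sum_{j=0}^{k}\binom{k}{j}^{3}$. That is, the right and left sides of Barrucand's identity $\sum_{k=0}^{n}\binom{n}{k}\sum_{j=0}^{k}\binom{k}{j}^{3}=\sum_{k=0}^{n}\binom{n}{k}^{2}\binom{2k}{k}$ count these words, respectively, by the number $n-k$ of $1$s in $w$ and by the number $n-k$ of positions in which both $w$ and $w'$ have a $1$.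
   Context: An abelian word (abelian square) of length $2n$ over an alphabet is a word of the form $ww'$ where $w$ and $w'$ each have $n$ letters and $w'$ is a rearrangement (permutation of the letters) of $w$. *)

theory Defs
  imports "HOL-Library.Multiset"
begin

text \<open>Here \<open>w'\<close> is a rearrangement of \<open>w\<close> exactly if both have the same multiset of letters.
  Both halves have length \<open>n\<close>, so \<open>w\<close> and \<open>w'\<close> are determined by the word \<open>w @ w'\<close>.\<close>

definition abelian_halves :: "'a set \<Rightarrow> nat \<Rightarrow> 'a list \<Rightarrow> 'a list \<Rightarrow> bool" where
  "abelian_halves A n w w' \<longleftrightarrow>
     w \<in> lists A \<and> w' \<in> lists A \<and> length w = n \<and> length w' = n \<and> mset w' = mset w"

definition abelian_words :: "'a set \<Rightarrow> nat \<Rightarrow> 'a list set" where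
  "abelian_words A n = {w @ w' | w w'. abelian_halves A n w w'}"

end

theory Submission
  imports Defs "HOL-Combinatorics.Multiset_Permutations"
begin

text \<open>
  Since both halves have the same length, an abelian word is the same thing as the pair
  \<open>(w, w')\<close> of its halves, and pairs are what is counted.

  To count by the number \<open>n - k\<close> of 1s in \<open>w\<close>, fix also the number \<open>j\<close> of 2s. Then the
  shared multiset of letters of \<open>w\<close> and \<open>w'\<close> is known, each half is one of its
  \<open>(n choose k) * (k choose j)\<close> arrangements, and the two are chosen independently. Since
  \<open>\<Sum>j\<le>k. (k choose j)\<^sup>2 = (2 * k) choose k\<close>, summing the squares over \<open>j\<close> gives the claim.

  To count by the number of positions with a common 1, choose the set \<open>S\<close> of these positions. Each of
  the other \<open>k\<close> positions carries one of eight letter pairs, as many as there are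
  vectors in \<open>{0, 1}\<^sup>3\<close>. Give a letter pair \<open>(a, b)\<close> the weight \<open>e\<^sub>a - e\<^sub>b\<close>. The word is abelian
  iff the weights sum to zero; the eight weights are twice \<open>0\<close> and the six roots of the
  lattice \<open>A\<^sub>2\<close>, which form a hexagon. The eight vectors of \<open>{0, 1}\<^sup>3\<close>, taken modulo
  \<open>(1, 1, 1)\<close>, also are twice \<open>0\<close> and a hexagon, so a linear isomorphism identifies the two
  configurations:
  \<open>12 = 100\<close>, \<open>23 = 010\<close>, \<open>31 = 001\<close>, \<open>21 = 011\<close>, \<open>32 = 101\<close>, \<open>13 = 110\<close>, \<open>22 = 000\<close>,
  \<open>33 = 111\<close>. Reading the three coordinates as sets \<open>X\<close>, \<open>Y\<close>, \<open>Z\<close> of positions, the abelian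
  condition says that \<open>(card X, card Y, card Z)\<close> is a multiple of \<open>(1, 1, 1)\<close> (lemma \<open>mset_eq_iff_card_sets_eq\<close>),
  and there are \<open>\<Sum>j\<le>k. (k choose j)^3\<close> such triples of subsets of a \<open>k\<close>-element set.
\<close>

section \<open>Words and their halves\<close>

lemma card_abelian_words_eq_card_halves:
  "card {w @ w' | w w'. abelian_halves A n w w' \<and> Q w w'} =
    card {(w, w'). abelian_halves A n w w' \<and> Q w w'}"
proof -
  let ?P = "\<lambda>w w'. abelian_halves A n w w' \<and> Q w w'"
  have "{w @ w' | w w'. ?P w w'} = (\<lambda>(w, w'). w @ w') ` {(w, w'). ?P w w'}"
    by auto
  moreover have "inj_on (\<lambda>(w, w'). w @ w') {(w, w'). ?P w w'}"
    by (auto simp: inj_on_def abelian_halves_def)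
  ultimately show ?thesis
    by (simp add: card_image)
qed

lemma finite_abelian_halves:
  assumes "finite A"
  shows "finite {(w, w'). abelian_halves A n w w'}"
proof (rule finite_subset)
  show "{(w, w'). abelian_halves A n w w'} \<subseteq>
      {w. set w \<subseteq> A \<and> length w = n} \<times> {w. set w \<subseteq> A \<and> length w = n}"
    by (auto simp: abelian_halves_def)
  show "finite ({w. set w \<subseteq> A \<and> length w = n} \<times> {w. set w \<subseteq> A \<and> length w = n})"
    using assms by (simp add: finite_lists_length_eq)
qed

text \<open>
  Both expressions for the number of all abelian words arise from classifying them by a statistic
  bounded by \<open>n\<close>; writing its value as \<open>n - k\<close> lets \<open>k\<close> run from \<open>0\<close> to \<open>n\<close>.
\<close>

lemma card_abelian_words_by_statistic:
  assumes "finite A" and bound: "\<And>w w'. abelian_halves A n w w' \<Longrightarrow> f w w' \<le> n"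
  shows "card (abelian_words A n) =
    (\<Sum>k=0..n. card {w @ w' | w w'. abelian_halves A n w w' \<and> f w w' = n - k})"
proof -
  have "{(w, w'). abelian_halves A n w w'} =
      (\<Union>k\<in>{0..n}. {(w, w'). abelian_halves A n w w' \<and> f w w' = n - k})"
  proof (intro set_eqI iffI)
    fix x assume x: "x \<in> {(w, w'). abelian_halves A n w w'}"
    obtain w w' where [simp]: "x = (w, w')" by fastforce
    have "n - (n - f w w') = f w w'" using bound x by simp
    then show "x \<in> (\<Union>k\<in>{0..n}. {(w, w'). abelian_halves A n w w' \<and> f w w' = n - k})"
      using x by (auto intro!: bexI[of _ "n - f w w'"])
  qed auto
  moreover have "card (\<Union>k\<in>{0..n}. {(w, w'). abelian_halves A n w w' \<and> f w w' = n - k}) =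
      (\<Sum>k=0..n. card {(w, w'). abelian_halves A n w w' \<and> f w w' = n - k})"
    by (rule card_UN_disjoint)
       (auto intro: finite_subset[OF _ finite_abelian_halves[OF assms(1), of n]])
  moreover have "card (abelian_words A n) = card {(w, w'). abelian_halves A n w w'}"
    unfolding abelian_words_def
    using card_abelian_words_eq_card_halves[of A n "\<lambda>_ _. True"] by simp
  moreover have "card {w @ w' | w w'. abelian_halves A n w w' \<and> f w w' = n - k} =
      card {(w, w'). abelian_halves A n w w' \<and> f w w' = n - k}" for k
    by (rule card_abelian_words_eq_card_halves)
  ultimately show ?thesis by simp
qed

section \<open>Counting by the number of 1s in one half\<close>

lemma mset_three_letters:
  fixes M :: "'a multiset"
  assumes "set_mset M \<subseteq> {a, b, c}" "a \<noteq> b" "a \<noteq> c" "b \<noteq> c"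
  shows "M = replicate_mset (count M a) a + replicate_mset (count M b) b + replicate_mset (count M c) c"
proof (rule multiset_eqI)
  fix x
  have "count M x = 0" if "x \<notin> {a, b, c}"
    using assms that by (meson count_eq_zero_iff subsetD)
  then show "count M x = count (replicate_mset (count M a) a + replicate_mset (count M b) b
      + replicate_mset (count M c) c) x"
    using assms by auto
qed

lemma card_permutations_three_letters:
  assumes "a \<noteq> b" "a \<noteq> c" "b \<noteq> c"
  shows "card (permutations_of_multiset
      (replicate_mset i a + replicate_mset j b + replicate_mset l c)) =
    ((i + j + l) choose (j + l)) * ((j + l) choose j)" (is "card (permutations_of_multiset ?M) = _")
proof -
  have "(\<Prod>x\<in>set_mset ?M. fact (count ?M x) :: nat) = (\<Prod>x\<in>{a, b, c}. fact (count ?M x))"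
    by (rule prod.mono_neutral_left) (auto simp: count_eq_zero_iff split: if_splits)
  also have "\<dots> = fact i * fact j * fact l"
    using assms by (simp add: mult.assoc)
  finally have prod: "(\<Prod>x\<in>set_mset ?M. fact (count ?M x) :: nat) = fact i * fact j * fact l" .
  have "fact (i + j + l) = (((i + j + l) choose (j + l)) * ((j + l) choose j)) * (fact i * fact j * fact l :: nat)"
  proof -
    have "fact (i + j + l) = fact (j + l) * fact i * ((i + j + l) choose (j + l) :: nat)"
      using binomial_fact_lemma[of "j + l" "i + j + l"] by simp
    also have "fact (j + l) = fact j * fact l * ((j + l) choose j :: nat)"
      using binomial_fact_lemma[of j "j + l"] by simp
    finally show ?thesis
      by (simp only: mult_ac)
  qed
  then have "fact (size ?M) div (fact i * fact j * fact l :: nat) =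
      ((i + j + l) choose (j + l)) * ((j + l) choose j)"
    by simp
  then show ?thesis
    by (simp only: card_permutations_of_multiset(1) prod)
qed

text \<open>
  The pairs with \<open>j\<close> 2s in each half form the square of the set of arrangements of one multiset
  \<open>M j\<close>, so the count is a sum of squares over \<open>j\<close>.
\<close>

lemma card_abelian_halves_count_1:
  assumes "k \<le> n"
  shows "card {(w, w'). abelian_halves {1, 2, 3 :: nat} n w w' \<and> count_list w 1 = n - k}
    = (n choose k)\<^sup>2 * ((2 * k) choose k)"
proof -
  define M where
    "M j = replicate_mset (n - k) 1 + replicate_mset j 2 + replicate_mset (k - j) (3 :: nat)" for j
  let ?P = "\<lambda>j. permutations_of_multiset (M j)"
  have count_2: "count (M j) 2 = j" for j
    by (simp add: M_def)
  have "{(w, w'). abelian_halves {1, 2, 3 :: nat} n w w' \<and> count_list w 1 = n - k} =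
      (\<Union>j\<in>{0..k}. ?P j \<times> ?P j)"
  proof (intro set_eqI iffI; clarify)
    fix w w' :: "nat list"
    assume h: "abelian_halves {1, 2, 3} n w w'" and c: "count_list w 1 = n - k"
    define j where "j = count (mset w) 2"
    have "set_mset (mset w) \<subseteq> {1, 2, 3}"
      using h by (auto simp: abelian_halves_def)
    note eq = mset_three_letters[OF this, simplified]
    have "n = size (mset w)"
      using h by (simp add: abelian_halves_def)
    also have "\<dots> = count (mset w) 1 + count (mset w) 2 + count (mset w) 3"
      by (subst eq) simp
    finally have "count (mset w) 3 = k - j" "j \<le> k"
      using c assms by (auto simp: count_mset j_def)
    then have "mset w = M j"
      using eq c by (simp add: M_def j_def count_mset)
    then show "(w, w') \<in> (\<Union>j\<in>{0..k}. ?P j \<times> ?P j)"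
      using h \<open>j \<le> k\<close> by (auto simp: abelian_halves_def permutations_of_multiset_def)
  next
    fix j w w'
    assume j: "j \<in> {0..k}" and "w \<in> ?P j" "w' \<in> ?P j"
    then have w: "mset w = M j" and w': "mset w' = M j"
      by (auto simp: permutations_of_multiset_def)
    have "set_mset (M j) \<subseteq> {1, 2, 3}" "size (M j) = n"
      using j assms by (auto simp: M_def)
    then have "set w \<subseteq> {1, 2, 3}" "set w' \<subseteq> {1, 2, 3}" "length w = n" "length w' = n"
      using w w' by (metis set_mset_mset size_mset)+
    moreover have "count_list w 1 = n - k"
      using w by (simp add: M_def flip: count_mset)
    ultimately show "abelian_halves {1, 2, 3} n w w' \<and> count_list w 1 = n - k"
      using w w' by (auto simp: abelian_halves_def)
  qed
  moreover have "card (\<Union>j\<in>{0..k}. ?P j \<times> ?P j) = (\<Sum>j=0..k. card (?P j \<times> ?P j))"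
  proof (rule card_UN_disjoint)
    show "\<forall>i\<in>{0..k}. \<forall>j\<in>{0..k}. i \<noteq> j \<longrightarrow> (?P i \<times> ?P i) \<inter> (?P j \<times> ?P j) = {}"
      using count_2 by (auto simp: permutations_of_multiset_def) metis
  qed auto
  moreover have "card (?P j) = (n choose k) * (k choose j)" if "j \<le> k" for j
    using card_permutations_three_letters[of 1 2 "3::nat" "n - k" j "k - j"] that assms
    by (simp add: M_def)
  ultimately have "card {(w, w'). abelian_halves {1, 2, 3 :: nat} n w w' \<and> count_list w 1 = n - k}
      = (\<Sum>j=0..k. ((n choose k) * (k choose j))\<^sup>2)"
    by (simp add: card_cartesian_product power2_eq_square)
  also have "\<dots> = (n choose k)\<^sup>2 * (\<Sum>j=0..k. (k choose j)\<^sup>2)"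
    by (simp add: power_mult_distrib sum_distrib_left)
  also have "(\<Sum>j=0..k. (k choose j)\<^sup>2) = (2 * k) choose k"
    using choose_square_sum[of k] by (simp add: atMost_atLeast0)
  finally show ?thesis .
qed

section \<open>Triples of sets of equal size\<close>

definition equal_card_triples :: "'a set \<Rightarrow> ('a set \<times> 'a set \<times> 'a set) set" where
  "equal_card_triples T =
    {(X, Y, Z). X \<subseteq> T \<and> Y \<subseteq> T \<and> Z \<subseteq> T \<and> card X = card Y \<and> card Y = card Z}"

lemma card_equal_card_triples:
  assumes "finite T"
  shows "finite (equal_card_triples T)"
    and "card (equal_card_triples T) = (\<Sum>j=0..card T. (card T choose j) ^ 3)"
proof -
  let ?N = "\<lambda>j. {X. X \<subseteq> T \<and> card X = j}"
  have eq: "equal_card_triples T = (\<Union>j\<in>{0..card T}. ?N j \<times> ?N j \<times> ?N j)"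
  proof (intro set_eqI iffI)
    fix t assume t: "t \<in> equal_card_triples T"
    then have "t \<in> ?N (card (fst t)) \<times> ?N (card (fst t)) \<times> ?N (card (fst t))"
      by (auto simp: equal_card_triples_def)
    moreover have "card (fst t) \<le> card T"
      using t by (intro card_mono[OF assms]) (auto simp: equal_card_triples_def)
    ultimately show "t \<in> (\<Union>j\<in>{0..card T}. ?N j \<times> ?N j \<times> ?N j)"
      by (intro UN_I) (simp_all only: atLeastAtMost_iff le0 simp_thms)
  qed (auto simp: equal_card_triples_def)
  have fin: "finite (?N j)" for j
    using assms by simp
  show "finite (equal_card_triples T)"
    unfolding eq using fin by blast
  have "card (equal_card_triples T) = (\<Sum>j=0..card T. card (?N j \<times> ?N j \<times> ?N j))"
    unfolding eq using fin by (intro card_UN_disjoint) auto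
  then show "card (equal_card_triples T) = (\<Sum>j=0..card T. (card T choose j) ^ 3)"
    using assms by (simp add: card_cartesian_product n_subsets power3_eq_cube mult.assoc)
qed

section \<open>Counting by the number of common 1s\<close>

definition common_ones :: "nat list \<Rightarrow> nat list \<Rightarrow> nat set" where
  "common_ones w w' = {p. p < length w \<and> w ! p = 1 \<and> w' ! p = 1}"

text \<open>
  The three coordinates of the hexagon isomorphism, as sets of positions. On the pair \<open>11\<close>,
  which it leaves out, all three are \<open>0\<close>.
\<close>

definition hexX :: "nat list \<Rightarrow> nat list \<Rightarrow> nat set" where
  "hexX w w' = {p. p < length w \<and> (w ! p, w' ! p) \<in> {(1,2), (1,3), (3,2), (3,3)}}"

definition hexY :: "nat list \<Rightarrow> nat list \<Rightarrow> nat set" where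
  "hexY w w' = {p. p < length w \<and> (w ! p, w' ! p) \<in> {(2,3), (2,1), (1,3), (3,3)}}"

definition hexZ :: "nat list \<Rightarrow> nat list \<Rightarrow> nat set" where
  "hexZ w w' = {p. p < length w \<and> (w ! p, w' ! p) \<in> {(3,1), (3,2), (2,1), (3,3)}}"

lemmas hex_defs = common_ones_def hexX_def hexY_def hexZ_def

lemma card_positions:
  fixes n :: nat
  shows "card {p. p < n \<and> P p} = (\<Sum>p<n. of_bool (P p))"
proof -
  have "{p. p < n \<and> P p} = {..<n} \<inter> {p. P p}" by auto
  then show ?thesis by (simp add: of_bool_def sum.If_cases)
qed

lemma count_mset_sum_positions:
  "count (mset w) a = (\<Sum>p<length w. of_bool (w ! p = a))"
proof -
  have "count (mset w) a = length (filter (\<lambda>x. x = a) w)"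
    by (induction w) auto
  then show ?thesis
    by (simp only: length_filter_conv_card card_positions)
qed

text \<open>
  The coordinates are chosen so that at every position, whatever the two letters, the indicators
  satisfy \<open>X - Z = [w = 1] - [w' = 1]\<close> and \<open>Y - X = [w = 2] - [w' = 2]\<close>. Summed over the positions,
  these relations compare the cardinalities; the 3s then agree because the lengths do.
\<close>

lemma mset_eq_iff_card_sets_eq:
  assumes w: "set w \<subseteq> {1, 2, 3}" and w': "set w' \<subseteq> {1, 2, 3}" and len: "length w' = length w"
  shows "mset w' = mset w \<longleftrightarrow>
    card (hexX w w') = card (hexY w w') \<and> card (hexY w w') = card (hexZ w w')"
proof -
  let ?c = "\<lambda>v a. count (mset v) a"
  have letters: "(w ! p = 1 \<or> w ! p = 2 \<or> w ! p = 3) \<and> (w' ! p = 1 \<or> w' ! p = 2 \<or> w' ! p = 3)"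
    if "p < length w" for p
  proof -
    have "w ! p \<in> {1, 2, 3}" "w' ! p \<in> {1, 2, 3}"
      using that w w' len nth_mem by (metis subsetD)+
    then show ?thesis by blast
  qed
  have c1: "card (hexX w w') + ?c w' 1 = card (hexZ w w') + ?c w 1"
    unfolding hexX_def hexZ_def card_positions count_mset_sum_positions len sum.distrib[symmetric]
  proof (rule sum.cong[OF refl])
    fix p assume "p \<in> {..<length w}"
    then have "p < length w" by simp
    from letters[OF this] show "of_bool ((w ! p, w' ! p) \<in> {(1,2), (1,3), (3,2), (3,3)}) + of_bool (w' ! p = 1) =
        (of_bool ((w ! p, w' ! p) \<in> {(3,1), (3,2), (2,1), (3,3)}) + of_bool (w ! p = 1) :: nat)"
      by (elim conjE disjE) simp_all
  qed
  have c2: "card (hexY w w') + ?c w' 2 = card (hexX w w') + ?c w 2"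
    unfolding hexX_def hexY_def card_positions count_mset_sum_positions len sum.distrib[symmetric]
  proof (rule sum.cong[OF refl])
    fix p assume "p \<in> {..<length w}"
    then have "p < length w" by simp
    from letters[OF this] show "of_bool ((w ! p, w' ! p) \<in> {(2,3), (2,1), (1,3), (3,3)}) + of_bool (w' ! p = 2) =
        (of_bool ((w ! p, w' ! p) \<in> {(1,2), (1,3), (3,2), (3,3)}) + of_bool (w ! p = 2) :: nat)"
      by (elim conjE disjE) simp_all
  qed
  have size: "length v = ?c v 1 + ?c v 2 + ?c v 3" if "set v \<subseteq> {1, 2, 3}" for v :: "nat list"
  proof -
    have "size (mset v) = ?c v 1 + ?c v 2 + ?c v 3"
      by (subst mset_three_letters[of "mset v" 1 2 3]) (use that in auto)
    then show ?thesis by simp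
  qed
  have "mset w' = mset w \<longleftrightarrow> ?c w' 1 = ?c w 1 \<and> ?c w' 2 = ?c w 2"
  proof
    assume c: "?c w' 1 = ?c w 1 \<and> ?c w' 2 = ?c w 2"
    then have "?c w' 3 = ?c w 3"
      using size[OF w] size[OF w'] len by simp
    then show "mset w' = mset w"
      using c mset_three_letters[of "mset w" 1 2 3] mset_three_letters[of "mset w'" 1 2 3] w w'
      by simp
  qed simp
  then show ?thesis
    using c1 c2 by linarith
qed

lemma hexagon_letters_inj:
  fixes a b c d :: nat
  assumes "a \<in> {1, 2, 3}" "b \<in> {1, 2, 3}" "c \<in> {1, 2, 3}" "d \<in> {1, 2, 3}"
    and "(a, b) = (1, 1) \<longleftrightarrow> (c, d) = (1, 1)"
    and "(a, b) \<in> {(1,2), (1,3), (3,2), (3,3)} \<longleftrightarrow> (c, d) \<in> {(1,2), (1,3), (3,2), (3,3)}"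
    and "(a, b) \<in> {(2,3), (2,1), (1,3), (3,3)} \<longleftrightarrow> (c, d) \<in> {(2,3), (2,1), (1,3), (3,3)}"
    and "(a, b) \<in> {(3,1), (3,2), (2,1), (3,3)} \<longleftrightarrow> (c, d) \<in> {(3,1), (3,2), (2,1), (3,3)}"
  shows "a = c \<and> b = d"
  using assms(1-4) assms(5-8)
  by (elim insertE emptyE) simp_all

text \<open>
  Position by position, the nine letter pairs correspond to the codes that put a position either
  in \<open>S\<close> alone, or outside \<open>S\<close> and in any of the eight combinations of \<open>X\<close>, \<open>Y\<close>, \<open>Z\<close>.
  This makes the coding a bijection on all pairs of words of length \<open>n\<close> over \<open>{1, 2, 3}\<close>;
  \<open>mset_eq_iff_card_sets_eq\<close> turns the abelian condition on one side into equality of cardinalities on the other.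
\<close>

lemma bij_betw_hexagon_code:
  "bij_betw (\<lambda>(w, w'). (common_ones w w', hexX w w', hexY w w', hexZ w w'))
     {(w, w'). abelian_halves {1, 2, 3} n w w' \<and> card (common_ones w w') = m}
     (SIGMA S:{S. S \<subseteq> {..<n} \<and> card S = m}. equal_card_triples ({..<n} - S))"
  (is "bij_betw ?code ?W ?C")
  unfolding bij_betw_def
proof (intro conjI subset_antisym)
  show "inj_on ?code ?W"
  proof (rule inj_onI; clarify)
    fix w w' v v' :: "nat list"
    assume h: "abelian_halves {1, 2, 3} n w w'" "abelian_halves {1, 2, 3} n v v'"
      and S: "common_ones w w' = common_ones v v'" and X: "hexX w w' = hexX v v'"
      and Y: "hexY w w' = hexY v v'" and Z: "hexZ w w' = hexZ v v'"
    have "w ! p = v ! p \<and> w' ! p = v' ! p" if p: "p < n" for p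
    proof -
      have "p \<in> common_ones w w' \<longleftrightarrow> p \<in> common_ones v v'" "p \<in> hexX w w' \<longleftrightarrow> p \<in> hexX v v'"
        "p \<in> hexY w w' \<longleftrightarrow> p \<in> hexY v v'" "p \<in> hexZ w w' \<longleftrightarrow> p \<in> hexZ v v'"
        using S X Y Z by auto
      moreover have "w ! p \<in> {1, 2, 3}" "w' ! p \<in> {1, 2, 3}" "v ! p \<in> {1, 2, 3}" "v' ! p \<in> {1, 2, 3}"
        "length w = n" "length v = n"
        using h p by (auto simp: abelian_halves_def in_lists_conv_set simp del: insert_iff)
      ultimately show ?thesis
        using p unfolding hex_defs by (intro hexagon_letters_inj) simp_all
    qed
    then show "w = v \<and> w' = v'"
      using h by (auto simp: abelian_halves_def intro!: nth_equalityI)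
  qed
  show "?code ` ?W \<subseteq> ?C"
  proof clarify
    fix w w' :: "nat list"
    assume h: "abelian_halves {1, 2, 3} n w w'" and m: "m = card (common_ones w w')"
    then show "common_ones w w' \<in> {S. S \<subseteq> {..<n} \<and> card S = card (common_ones w w')} \<and>
        (hexX w w', hexY w w', hexZ w w') \<in> equal_card_triples ({..<n} - common_ones w w')"
      using mset_eq_iff_card_sets_eq[of w w']
      by (auto simp: abelian_halves_def equal_card_triples_def hex_defs)
  qed
  show "?C \<subseteq> ?code ` ?W"
  proof clarify
    fix S X Y Z :: "nat set"
    assume S: "S \<subseteq> {..<n}" and m: "m = card S"
      and "(X, Y, Z) \<in> equal_card_triples ({..<n} - S)"
    then have sub: "X \<subseteq> {..<n} - S" "Y \<subseteq> {..<n} - S" "Z \<subseteq> {..<n} - S"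
      and cards: "card X = card Y" "card Y = card Z"
      by (auto simp: equal_card_triples_def)
    \<comment> \<open>The code of each of the nine letter pairs, read backwards.\<close>
    define ab :: "nat \<Rightarrow> nat \<times> nat" where "ab p =
      (if p \<in> S then (1, 1)
       else if p \<in> X then
         if p \<in> Y then if p \<in> Z then (3, 3) else (1, 3)
         else if p \<in> Z then (3, 2) else (1, 2)
       else
         if p \<in> Y then if p \<in> Z then (2, 1) else (2, 3)
         else if p \<in> Z then (3, 1) else (2, 2))" for p
    have disj: "p \<in> S \<Longrightarrow> p \<notin> X \<and> p \<notin> Y \<and> p \<notin> Z" for p
      using sub by auto
    have ab: "ab p \<in> {1, 2, 3} \<times> {1, 2, 3 :: nat}" "ab p = (1, 1) \<longleftrightarrow> p \<in> S"
        "ab p \<in> {(1,2), (1,3), (3,2), (3,3)} \<longleftrightarrow> p \<in> X"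
        "ab p \<in> {(2,3), (2,1), (1,3), (3,3)} \<longleftrightarrow> p \<in> Y"
        "ab p \<in> {(3,1), (3,2), (2,1), (3,3)} \<longleftrightarrow> p \<in> Z" for p
      using disj[of p] by (simp_all add: ab_def)
    define w w' where "w = map (\<lambda>p. fst (ab p)) [0..<n]" and "w' = map (\<lambda>p. snd (ab p)) [0..<n]"
    have nth: "(w ! p, w' ! p) = ab p" if "p < n" for p
      using that by (simp add: w_def w'_def)
    have len: "length w = n" "length w' = n"
      by (simp_all add: w_def w'_def)
    have letters: "set w \<subseteq> {1, 2, 3}" "set w' \<subseteq> {1, 2, 3}"
    proof -
      have "fst (ab p) \<in> {1, 2, 3}" "snd (ab p) \<in> {1, 2, 3}" for p
        using ab(1)[of p] by (simp_all only: mem_Times_iff)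
      then show "set w \<subseteq> {1, 2, 3}" "set w' \<subseteq> {1, 2, 3}"
        by (auto simp: w_def w'_def simp del: insert_iff)
    qed
    have "common_ones w w' = {p. p < n \<and> (w ! p, w' ! p) = (1, 1)}"
      by (simp add: common_ones_def len)
    also have "\<dots> = {p. p < n \<and> p \<in> S}"
      by (simp only: nth ab(2) cong: conj_cong)
    finally have S_eq: "common_ones w w' = S"
      using S by auto
    have "hexX w w' = {p. p < n \<and> p \<in> X}" "hexY w w' = {p. p < n \<and> p \<in> Y}"
        "hexZ w w' = {p. p < n \<and> p \<in> Z}"
      unfolding hex_defs len by (simp_all only: nth ab(3-5) cong: conj_cong)
    then have X_eq: "hexX w w' = X" and Y_eq: "hexY w w' = Y" and Z_eq: "hexZ w w' = Z"
      using sub by auto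
    have "abelian_halves {1, 2, 3} n w w'"
      using mset_eq_iff_card_sets_eq[OF letters] len letters cards
      by (auto simp: abelian_halves_def X_eq Y_eq Z_eq)
    then have "(w, w') \<in> ?W"
      by (simp add: S_eq m)
    moreover have "?code (w, w') = (S, X, Y, Z)"
      by (simp add: S_eq X_eq Y_eq Z_eq)
    ultimately show "(S, X, Y, Z) \<in> ?code ` {(w, w'). abelian_halves {1, 2, 3} n w w' \<and> card (common_ones w w') = card S}"
      unfolding m by (metis (no_types, lifting) image_eqI)
  qed
qed

lemma card_abelian_halves_common_ones:
  assumes "k \<le> n"
  shows "card {(w, w'). abelian_halves {1, 2, 3} n w w' \<and> card (common_ones w w') = n - k}
    = (n choose k) * (\<Sum>j=0..k. (k choose j) ^ 3)"
proof -
  let ?\<S> = "{S. S \<subseteq> {..<n} \<and> card S = n - k}"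
  have "card {(w, w'). abelian_halves {1, 2, 3} n w w' \<and> card (common_ones w w') = n - k} =
      card (SIGMA S:?\<S>. equal_card_triples ({..<n} - S))"
    by (rule bij_betw_same_card[OF bij_betw_hexagon_code])
  also have "\<dots> = (\<Sum>S\<in>?\<S>. card (equal_card_triples ({..<n} - S)))"
    by (rule card_SigmaI) (auto intro: card_equal_card_triples(1))
  also have "\<dots> = (\<Sum>S\<in>?\<S>. \<Sum>j=0..k. (k choose j) ^ 3)"
  proof (rule sum.cong[OF refl])
    fix S assume "S \<in> ?\<S>"
    then have "card ({..<n} - S) = k"
      using assms by (auto simp: card_Diff_subset finite_subset)
    then show "card (equal_card_triples ({..<n} - S)) = (\<Sum>j=0..k. (k choose j) ^ 3)"
      by (simp add: card_equal_card_triples(2))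
  qed
  also have "\<dots> = (n choose k) * (\<Sum>j=0..k. (k choose j) ^ 3)"
    using assms by (simp add: n_subsets flip: binomial_symmetric)
  finally show ?thesis .
qed

lemma card_common_ones_shifted:
  assumes "length w = n"
  shows "card {p \<in> {1..n}. w ! (p - 1) = 1 \<and> w' ! (p - 1) = 1} = card (common_ones w w')"
proof -
  have "{p \<in> {1..n}. w ! (p - 1) = 1 \<and> w' ! (p - 1) = 1} = Suc ` common_ones w w'"
  proof (intro set_eqI iffI)
    fix p assume "p \<in> {p \<in> {1..n}. w ! (p - 1) = 1 \<and> w' ! (p - 1) = 1}"
    then show "p \<in> Suc ` common_ones w w'"
      by (intro image_eqI[of _ _ "p - 1"]) (auto simp: common_ones_def assms)
  qed (auto simp: common_ones_def assms)
  then show ?thesis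
    by (simp add: card_image)
qed

section \<open>The two counts of abelian words\<close>

theorem proposition1:
  fixes n :: nat
  shows "(\<forall>k\<le>n.
            card {w @ w' | w w'. abelian_halves {1, 2, 3 :: nat} n w w' \<and> count_list w 1 = n - k}
              = (n choose k)\<^sup>2 * ((2 * k) choose k)
          \<and> card {w @ w' | w w'. abelian_halves {1, 2, 3 :: nat} n w w' \<and>
                     card {p \<in> {1..n}. w ! (p - 1) = 1 \<and> w' ! (p - 1) = 1} = n - k}
              = (n choose k) * (\<Sum>j=0..k. (k choose j) ^ 3))
       \<and> card (abelian_words {1, 2, 3 :: nat} n) = (\<Sum>k=0..n. (n choose k) * (\<Sum>j=0..k. (k choose j) ^ 3))
       \<and> card (abelian_words {1, 2, 3 :: nat} n) = (\<Sum>k=0..n. (n choose k)\<^sup>2 * ((2 * k) choose k))"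
proof -
  let ?H = "abelian_halves {1, 2, 3 :: nat} n"
  let ?ones = "\<lambda>w w'. card {p \<in> {1..n}. w ! (p - 1) = (1 :: nat) \<and> w' ! (p - 1) = (1 :: nat)}"
  have len: "length w = n" if "?H w w'" for w w'
    using that by (simp add: abelian_halves_def)
  have a: "card {w @ w' | w w'. ?H w w' \<and> count_list w 1 = n - k} = (n choose k)\<^sup>2 * ((2 * k) choose k)"
    if "k \<le> n" for k
    using that by (simp only: card_abelian_words_eq_card_halves card_abelian_halves_count_1)
  have "{(w, w'). ?H w w' \<and> ?ones w w' = n - k} =
      {(w, w'). ?H w w' \<and> card (common_ones w w') = n - k}" for k
    using len card_common_ones_shifted by auto
  then have b: "card {w @ w' | w w'. ?H w w' \<and> ?ones w w' = n - k} =
      (n choose k) * (\<Sum>j=0..k. (k choose j) ^ 3)" if "k \<le> n" for k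
    using that by (simp only: card_abelian_words_eq_card_halves card_abelian_halves_common_ones)
  have "?ones w w' \<le> n" for w w'
  proof -
    have "?ones w w' \<le> card {1..n}"
      by (rule card_mono) auto
    then show ?thesis by simp
  qed
  then have "card (abelian_words {1, 2, 3 :: nat} n) =
      (\<Sum>k=0..n. card {w @ w' | w w'. ?H w w' \<and> ?ones w w' = n - k})"
    by (intro card_abelian_words_by_statistic) auto
  moreover have "card (abelian_words {1, 2, 3 :: nat} n) =
      (\<Sum>k=0..n. card {w @ w' | w w'. ?H w w' \<and> count_list w 1 = n - k})"
    by (intro card_abelian_words_by_statistic) (simp, metis count_le_length len)
  ultimately show ?thesis
    using a b by simp
qed

end
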